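(* For every $0<\delta<1$, there exists an integer $n_0=n_0(\delta)$ for which the following holds. Suppose that $G$ is a graph with $|V(G)|=n\geq n_0$, with minimum degree $\delta(G)\ge \delta n$, and with chromatic number $\chi(G)>32/\delta$. Then for every positive integer $b\le \frac{\delta^2 n}{6400(\log_2 n)^2}$, Maker has a winning strategy in the $(1:b)$ odd cycle game $\mathcal{NC}_2(G)$ played on the edge set $E(G)$.
   Context: Graphs are finite and simple. In an $(a:b)$ Maker-Breaker game $(X,\mathcal{F})$, where $X$ is a finite set (the board) and $\mathcal{F}\subseteq 2^X$ is the family of winning sets, two players, Maker and Breaker, take turns claiming previously unclaimed elements of $X$. Maker claims exactly $a$ elements per turn and Breaker claims exactly $b$ elements per turn (the last turn may have fewer elements available), and Maker is the first player. The game ends when every element of $X$ has been claimed. Maker wins if he fully claims some member of $\mathcal{F}$; otherwise Breaker wins. The odd cycle game $\mathcal{NC}_2(G)$ is the game with board $X=E(G)$ whose winning sets are the edge sets of all subgraphs $H\subseteq G$ that are not $2$-colorable; equivalently, Maker wins if and only if the edges he claims contain an odd cycle. *)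

theory Defs
  imports Complex_Main
begin

section \<open>Finite simple graphs\<close>

definition simple_graph :: "'a set \<Rightarrow> 'a set set \<Rightarrow> bool" where
  "simple_graph V E \<longleftrightarrow> finite V \<and> (\<forall>e\<in>E. e \<subseteq> V \<and> card e = 2)"

definition subgraph :: "'a set \<Rightarrow> 'a set set \<Rightarrow> 'a set \<Rightarrow> 'a set set \<Rightarrow> bool" where
  "subgraph W F V E \<longleftrightarrow> simple_graph W F \<and> W \<subseteq> V \<and> F \<subseteq> E"

definition vertex_degree :: "'a set set \<Rightarrow> 'a \<Rightarrow> nat" where
  "vertex_degree E v = card {e \<in> E. v \<in> e}"

text \<open>This is meaningful only for a nonempty vertex set.\<close>

definition min_degree :: "'a set \<Rightarrow> 'a set set \<Rightarrow> nat" where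
  "min_degree V E = Min (vertex_degree E ` V)"

definition colorable :: "'a set \<Rightarrow> 'a set set \<Rightarrow> nat \<Rightarrow> bool" where
  "colorable V E k \<longleftrightarrow>
     (\<exists>c :: 'a \<Rightarrow> nat. (\<forall>v\<in>V. c v < k) \<and> (\<forall>u v. {u, v} \<in> E \<longrightarrow> c u \<noteq> c v))"

definition chromatic_number :: "'a set \<Rightarrow> 'a set set \<Rightarrow> nat" where
  "chromatic_number V E = (LEAST k. colorable V E k)"

section \<open>Maker-Breaker games\<close>

text \<open>
  A play is recorded as the list of the sets of elements claimed in the successive turns.
  Maker moves first, so the turns with even index are Maker's and those with odd index
  are Breaker's. The play stops once the board is exhausted: no move is legal then.
\<close>

definition free_elements :: "'e set \<Rightarrow> 'e set list \<Rightarrow> 'e set" where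
  "free_elements X h = X - \<Union> (set h)"

definition legal_move :: "'e set \<Rightarrow> nat \<Rightarrow> 'e set list \<Rightarrow> 'e set \<Rightarrow> bool" where
  "legal_move X k h S \<longleftrightarrow>
     free_elements X h \<noteq> {} \<and> S \<subseteq> free_elements X h \<and>
     card S = min k (card (free_elements X h))"

definition is_play :: "nat \<Rightarrow> nat \<Rightarrow> 'e set \<Rightarrow> 'e set list \<Rightarrow> bool" where
  "is_play a b X h \<longleftrightarrow>
     (\<forall>i<length h. legal_move X (if even i then a else b) (take i h) (h ! i))"

definition maker_claims :: "'e set list \<Rightarrow> 'e set" where
  "maker_claims h = (\<Union>i\<in>{i. i < length h \<and> even i}. h ! i)"

definition follows_strategy :: "('e set list \<Rightarrow> 'e set) \<Rightarrow> 'e set list \<Rightarrow> bool" where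
  "follows_strategy s h \<longleftrightarrow> (\<forall>i<length h. even i \<longrightarrow> h ! i = s (take i h))"

text \<open>
  The first conjunct guarantees that the strategy never prescribes an illegal move; without it,
  a strategy could win vacuously by having no complete play that follows it.
\<close>

definition maker_winning_strategy ::
  "nat \<Rightarrow> nat \<Rightarrow> 'e set \<Rightarrow> 'e set set \<Rightarrow> ('e set list \<Rightarrow> 'e set) \<Rightarrow> bool" where
  "maker_winning_strategy a b X \<F> s \<longleftrightarrow>
     (\<forall>h. is_play a b X h \<and> follows_strategy s h \<and> even (length h) \<and> free_elements X h \<noteq> {}
            \<longrightarrow> legal_move X a h (s h)) \<and>
     (\<forall>h. is_play a b X h \<and> follows_strategy s h \<and> free_elements X h = {}
            \<longrightarrow> (\<exists>F\<in>\<F>. F \<subseteq> maker_claims h))"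

definition maker_has_winning_strategy :: "nat \<Rightarrow> nat \<Rightarrow> 'e set \<Rightarrow> 'e set set \<Rightarrow> bool" where
  "maker_has_winning_strategy a b X \<F> \<longleftrightarrow> (\<exists>s. maker_winning_strategy a b X \<F> s)"

section \<open>The odd cycle game\<close>

definition odd_cycle_winning_sets :: "'a set \<Rightarrow> 'a set set \<Rightarrow> 'a set set set" where
  "odd_cycle_winning_sets V E = {F. \<exists>W. subgraph W F V E \<and> \<not> colorable W F 2}"

end

theory Submission
  imports Defs "HOL-Analysis.Convex" "HOL-Analysis.Harmonic_Numbers" "HOL-Library.FuncSet"
begin

text \<open>
  A connected bipartite graph together with one more edge inside one of its sides contains an odd
  cycle. Maker therefore looks for a vertex class \<open>W\<close> and a bipartition of \<open>W\<close> such that \<open>G\<close> has an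
  edge \<open>uv\<close> inside one side and such that the bipartite part of \<open>G\<close> on \<open>W\<close> is so well connected that
  he can build a spanning connected subgraph of it. He claims \<open>uv\<close> at once, before Breaker can
  destroy what may be a handful of such edges, and then plays for connectivity.

  To find \<open>W\<close>, take a maximum cut of \<open>G\<close>; the bipartite graph \<open>B\<close> of its crossing edges has
  minimum degree at least \<open>\<delta> * n / 2\<close> (\<open>max_cut_keeps_half_of_each_degree\<close>). Among all partitions of
  the vertices into at most \<open>K\<close> classes, where \<open>K\<close> is about \<open>4 / \<delta>\<close>, choose one that is optimal for
  the number of edges of \<open>B\<close> inside classes, penalised by the entropy of the class sizes. Optimality
  forces, in every class, each set \<open>S\<close> of at most half of the vertices to send at least
  \<open>2 * b * log 2 n * card S\<close> edges of \<open>B\<close> to the rest of its class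
  (\<open>robustly_connected_partition\<close>). The classes and the two sides of the cut define fewer vertex sets
  than the chromatic number of \<open>G\<close>, so one of these sets is not independent
  (\<open>edge_inside_class_and_side\<close>); it supplies \<open>uv\<close> and \<open>W\<close>.

  Building a connected graph means claiming an edge of every cut of \<open>B\<close> inside \<open>W\<close>. A cut that
  separates \<open>s\<close> vertices has at least \<open>2 * b * s * log 2 n\<close> edges, and there are at most
  \<open>n choose s\<close> such cuts, so a potential function argument with weights \<open>2 powr (- size / b)\<close> shows
  that Maker can hit them all (\<open>maker_claims_element_and_hits_family\<close>). That the resulting
  edges are not 2-colourable is checked directly on colourings, without exhibiting a cycle
  (\<open>not_two_colorable_if_cuts_hit\<close>).
\<close>

section \<open>Hitting every set of a family as Maker with bias one\<close>

lemma is_play_snoc: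
  "is_play a b X (h @ [S]) \<longleftrightarrow>
     is_play a b X h \<and> legal_move X (if even (length h) then a else b) h S"
  unfolding is_play_def
  by (auto simp: less_Suc_eq nth_append all_conj_distrib)

lemma follows_strategy_snoc:
  "follows_strategy s (h @ [S]) \<longleftrightarrow>
     follows_strategy s h \<and> (even (length h) \<longrightarrow> S = s h)"
  unfolding follows_strategy_def
  by (auto simp: less_Suc_eq nth_append all_conj_distrib)

lemma free_elements_Nil: "free_elements X [] = X"
  by (simp add: free_elements_def)

lemma free_elements_snoc: "free_elements X (h @ [S]) = free_elements X h - S"
  by (auto simp: free_elements_def)

lemma maker_claims_Nil: "maker_claims [] = {}"
  by (simp add: maker_claims_def)

lemma maker_claims_snoc:
  "maker_claims (h @ [S]) = maker_claims h \<union> (if even (length h) then S else {})"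
  unfolding maker_claims_def
  by (auto simp: less_Suc_eq nth_append split: if_splits)

lemma maker_claims_subset:
  assumes "is_play a b X h"
  shows "maker_claims h \<subseteq> X"
  using assms
proof (induction h rule: rev_induct)
  case Nil
  then show ?case by (simp add: maker_claims_Nil)
next
  case (snoc S h)
  then show ?case
    by (auto simp: is_play_snoc maker_claims_snoc legal_move_def free_elements_def)
qed

text \<open>
  The weight of a set that Maker still has to hit: it is one when Breaker owns the whole set, and
  a full Breaker turn inside the set at most doubles it.
\<close>

definition weight :: "nat \<Rightarrow> 'e set \<Rightarrow> 'e set \<Rightarrow> real" where
  "weight b U C = 2 powr (- real (card (C \<inter> U)) / real b)"

definition danger :: "'e set set \<Rightarrow> nat \<Rightarrow> 'e set \<Rightarrow> 'e set \<Rightarrow> real" where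
  "danger \<C> b M U = (\<Sum>C | C \<in> \<C> \<and> C \<inter> M = {}. weight b U C)"

definition load :: "'e set set \<Rightarrow> nat \<Rightarrow> 'e set \<Rightarrow> 'e set \<Rightarrow> 'e \<Rightarrow> real" where
  "load \<C> b M U f = (\<Sum>C | C \<in> \<C> \<and> C \<inter> M = {} \<and> f \<in> C. weight b U C)"

lemma weight_cong: "C \<inter> U = C \<inter> U' \<Longrightarrow> weight b U C = weight b U' C"
  by (simp add: weight_def)

lemma weight_pos: "weight b U C > 0"
  by (simp add: weight_def)

lemma two_powr_le_chord:
  fixes x :: real
  assumes "0 \<le> x" "x \<le> 1"
  shows "2 powr x \<le> 1 + x"
proof -
  have "exp ((1 - x) *\<^sub>R 0 + x *\<^sub>R ln 2) \<le> (1 - x) * exp 0 + x * exp (ln 2 :: real)"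
    by (rule convex_onD[OF exp_convex]) (use assms in auto)
  then show ?thesis
    by (simp add: powr_def)
qed

text \<open>
  By convexity, a Breaker turn raises each weight by at most the fraction
  \<open>1 / b\<close> per claimed element, so the total increase is an average of loads.
\<close>

lemma weight_after_breaker:
  assumes "finite U" "T \<subseteq> U" "card T \<le> b" "0 < b"
  shows "weight b (U - T) C \<le> weight b U C * (1 + real (card (C \<inter> T)) / real b)"
proof -
  have fT: "finite T" using assms finite_subset by blast
  have split: "C \<inter> U = (C \<inter> (U - T)) \<union> (C \<inter> T)" using assms by auto
  have "card (C \<inter> U) = card (C \<inter> (U - T)) + card (C \<inter> T)"
    by (subst split, rule card_Un_disjoint) (use assms fT in auto)
  then have "weight b (U - T) C = weight b U C * 2 powr (real (card (C \<inter> T)) / real b)"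
    by (simp add: weight_def flip: powr_add) (simp add: add_divide_distrib diff_divide_distrib)
  also have "card (C \<inter> T) \<le> b"
    using assms fT by (meson Int_lower2 card_mono order_trans)
  then have "2 powr (real (card (C \<inter> T)) / real b) \<le> 1 + real (card (C \<inter> T)) / real b"
    using assms by (intro two_powr_le_chord) auto
  finally show ?thesis
    using weight_pos[of b U C] by (simp add: mult_left_mono)
qed

lemma danger_after_breaker:
  assumes "finite \<C>" "finite U" "T \<subseteq> U" "card T \<le> b" "0 < b"
  shows "danger \<C> b M (U - T) \<le> danger \<C> b M U + (\<Sum>t\<in>T. load \<C> b M U t) / real b"
proof -
  define I where "I = {C \<in> \<C>. C \<inter> M = {}}"
  have fI: "finite I" using assms by (simp add: I_def)
  have fT: "finite T" using assms finite_subset by blast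
  have "danger \<C> b M (U - T) \<le> (\<Sum>C\<in>I. weight b U C * (1 + real (card (C \<inter> T)) / real b))"
    unfolding danger_def I_def[symmetric] by (intro sum_mono weight_after_breaker assms)
  also have "\<dots> = danger \<C> b M U + (\<Sum>C\<in>I. weight b U C * real (card (C \<inter> T))) / real b"
    by (simp add: danger_def I_def ring_distribs sum.distrib sum_divide_distrib)
  also have "(\<Sum>C\<in>I. weight b U C * real (card (C \<inter> T)))
      = (\<Sum>C\<in>I. \<Sum>t\<in>T. if t \<in> C then weight b U C else 0)"
  proof (rule sum.cong[OF refl])
    fix C
    have "(\<Sum>t\<in>T. if t \<in> C then weight b U C else 0) = (\<Sum>t\<in>T \<inter> C. weight b U C)"
      by (rule sum.inter_restrict[OF fT, symmetric])
    then show "weight b U C * real (card (C \<inter> T))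
        = (\<Sum>t\<in>T. if t \<in> C then weight b U C else 0)"
      by (simp add: Int_commute)
  qed
  also have "\<dots> = (\<Sum>t\<in>T. \<Sum>C\<in>I. if t \<in> C then weight b U C else 0)"
    by (rule sum.swap)
  also have "\<dots> = (\<Sum>t\<in>T. load \<C> b M U t)"
  proof (rule sum.cong[OF refl])
    fix t
    have "{C \<in> \<C>. C \<inter> M = {} \<and> t \<in> C} = {C \<in> I. t \<in> C}" by (auto simp: I_def)
    then show "(\<Sum>C\<in>I. if t \<in> C then weight b U C else 0) = load \<C> b M U t"
      using fI by (simp add: load_def sum.inter_filter)
  qed
  finally show ?thesis .
qed

lemma danger_after_maker:
  assumes "finite \<C>"
  shows "danger \<C> b (insert f M) (U - {f}) = danger \<C> b M U - load \<C> b M U f"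
proof -
  let ?A = "{C \<in> \<C>. C \<inter> insert f M = {}}" and ?B = "{C \<in> \<C>. C \<inter> M = {} \<and> f \<in> C}"
  have "danger \<C> b M U = (\<Sum>C\<in>?A \<union> ?B. weight b U C)"
    unfolding danger_def by (rule sum.cong) auto
  also have "\<dots> = (\<Sum>C\<in>?A. weight b U C) + (\<Sum>C\<in>?B. weight b U C)"
    by (rule sum.union_disjoint) (use assms in auto)
  also have "(\<Sum>C\<in>?A. weight b U C) = danger \<C> b (insert f M) (U - {f})"
    unfolding danger_def by (intro sum.cong weight_cong) auto
  finally show ?thesis by (simp add: load_def)
qed

text \<open>
  Taking an element of largest load pays for everything Breaker can do in his next turn: he takes
  at most \<open>b\<close> elements, each of load at most the one that Maker removed, and each of them
  contributes only a \<open>1 / b\<close> fraction of its load.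
\<close>

lemma danger_round:
  assumes fin: "finite \<C>" "finite U" and b: "0 < b" and f: "f \<in> U"
    and heaviest: "\<And>g. g \<in> U \<Longrightarrow> load \<C> b M U g \<le> load \<C> b M U f"
    and T: "T \<subseteq> U - {f}" "card T \<le> b"
  shows "danger \<C> b (insert f M) (U - {f} - T) \<le> danger \<C> b M U"
proof -
  let ?M = "insert f M" and ?U = "U - {f}"
  have load_le: "load \<C> b ?M ?U t \<le> load \<C> b M U f" if "t \<in> T" for t
  proof -
    have "load \<C> b ?M ?U t = (\<Sum>C | C \<in> \<C> \<and> C \<inter> ?M = {} \<and> t \<in> C. weight b U C)"
      unfolding load_def by (intro sum.cong weight_cong) auto
    also have "\<dots> \<le> load \<C> b M U t"
      unfolding load_def by (rule sum_mono2) (use fin weight_pos[of b U] in \<open>auto simp: less_imp_le\<close>)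
    also have "\<dots> \<le> load \<C> b M U f" using that T heaviest by auto
    finally show ?thesis .
  qed
  have load_nonneg: "0 \<le> load \<C> b M U f"
    unfolding load_def by (rule sum_nonneg) (simp add: weight_pos less_imp_le)
  have "(\<Sum>t\<in>T. load \<C> b ?M ?U t) \<le> real (card T) * load \<C> b M U f"
    using load_le by (rule sum_bounded_above)
  also have "\<dots> \<le> real b * load \<C> b M U f"
    using T load_nonneg by (intro mult_right_mono) auto
  finally have "(\<Sum>t\<in>T. load \<C> b ?M ?U t) / real b \<le> load \<C> b M U f"
    using b by (simp add: divide_le_eq mult.commute)
  moreover have "danger \<C> b ?M (?U - T) \<le> danger \<C> b ?M ?U + (\<Sum>t\<in>T. load \<C> b ?M ?U t) / real b"
    by (rule danger_after_breaker) (use fin T b in auto)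
  ultimately show ?thesis
    using danger_after_maker[OF fin(1), of b f M U] by linarith
qed

text \<open>
  The Erdos--Selfridge--Beck criterion, in a form where Maker spends his first turn on an element
  of his choice. Breaker's answer to that turn at most doubles the danger, which explains the
  bound one half; from then on the danger stays below one, and a set lost to Breaker would
  contribute one on its own.
\<close>

theorem maker_claims_element_and_hits_family:
  assumes X: "finite X" "e \<in> X" and fin: "finite \<C>" and b: "0 < b"
    and small: "(\<Sum>C\<in>\<C>. weight b X C) < 1 / 2"
    and win: "\<And>M. \<lbrakk>M \<subseteq> X; e \<in> M; \<And>C. C \<in> \<C> \<Longrightarrow> C \<inter> M \<noteq> {}\<rbrakk> \<Longrightarrow> \<exists>F\<in>\<F>. F \<subseteq> M"
  shows "maker_has_winning_strategy 1 b X \<F>"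
proof -
  define heaviest where "heaviest h f \<longleftrightarrow> f \<in> free_elements X h \<and>
      (\<forall>g\<in>free_elements X h. load \<C> b (maker_claims h) (free_elements X h) g
                            \<le> load \<C> b (maker_claims h) (free_elements X h) f)" for h f
  define s where "s h = (if h = [] then {e} else {SOME f. heaviest h f})" for h
  have fin_free: "finite (free_elements X h)" for h
    using X by (simp add: free_elements_def)
  have heaviest_exists: "heaviest h (SOME f. heaviest h f)" if "free_elements X h \<noteq> {}" for h
  proof (rule someI_ex)
    let ?L = "load \<C> b (maker_claims h) (free_elements X h)"
    have "Max (?L ` free_elements X h) \<in> ?L ` free_elements X h"
      using that fin_free by (intro Max_in) auto
    then obtain f where "f \<in> free_elements X h" "?L f = Max (?L ` free_elements X h)" by auto
    then show "\<exists>f. heaviest h f"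
      using fin_free unfolding heaviest_def by (metis Max_ge finite_imageI imageI)
  qed
  have s_legal: "legal_move X 1 h (s h)" if "free_elements X h \<noteq> {}" for h
  proof -
    have "card (free_elements X h) > 0" using that fin_free by (simp add: card_gt_0_iff)
    moreover have "s h \<subseteq> free_elements X h"
      using heaviest_exists[OF that] X by (auto simp: s_def heaviest_def free_elements_Nil)
    ultimately show ?thesis using that by (auto simp: legal_move_def s_def)
  qed
  \<comment> \<open>The invariant after a Maker turn already quantifies over all answers of Breaker, because
      the danger right after Breaker's turn is what the strategy controls.\<close>
  have invariant: "(h \<noteq> [] \<longrightarrow> e \<in> maker_claims h) \<and>
      (if even (length h) then h \<noteq> [] \<longrightarrow> danger \<C> b (maker_claims h) (free_elements X h) < 1
       else \<forall>T\<subseteq>free_elements X h. card T \<le> b \<longrightarrow>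
              danger \<C> b (maker_claims h) (free_elements X h - T) < 1)"
    if "is_play 1 b X h" "follows_strategy s h" for h
    using that
  proof (induction h rule: rev_induct)
    case Nil
    then show ?case by simp
  next
    case (snoc S h)
    then have IH: "(h \<noteq> [] \<longrightarrow> e \<in> maker_claims h) \<and>
      (if even (length h) then h \<noteq> [] \<longrightarrow> danger \<C> b (maker_claims h) (free_elements X h) < 1
       else \<forall>T\<subseteq>free_elements X h. card T \<le> b \<longrightarrow>
              danger \<C> b (maker_claims h) (free_elements X h - T) < 1)"
      and legal: "legal_move X (if even (length h) then 1 else b) h S"
      and follows: "even (length h) \<longrightarrow> S = s h"
      by (auto simp: is_play_snoc follows_strategy_snoc)
    consider "h = []" | "h \<noteq> []" "even (length h)" | "odd (length h)" by fastforce
    then show ?case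
    proof cases
      case 1
      then have S: "S = {e}" using follows by (simp add: s_def)
      have "danger \<C> b {e} (X - {e} - T) < 1" if T: "T \<subseteq> X - {e}" "card T \<le> b" for T
      proof -
        let ?I = "{C \<in> \<C>. C \<inter> {e} = {}}"
        have fT: "finite T" using T X by (meson finite_Diff finite_subset)
        have "danger \<C> b {e} (X - {e} - T) \<le> (\<Sum>C\<in>?I. 2 * weight b X C)"
          unfolding danger_def
        proof (rule sum_mono)
          fix C assume C: "C \<in> ?I"
          have "weight b (X - {e} - T) C = weight b (X - T) C"
            by (rule weight_cong) (use C in auto)
          also have "\<dots> \<le> weight b X C * (1 + real (card (C \<inter> T)) / real b)"
            by (rule weight_after_breaker) (use T X b in auto)
          also have "\<dots> \<le> weight b X C * 2"
          proof -
            have "card (C \<inter> T) \<le> b" using T fT by (meson Int_lower2 card_mono order_trans)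
            then show ?thesis using b weight_pos[of b X C] by (intro mult_left_mono) auto
          qed
          finally show "weight b (X - {e} - T) C \<le> 2 * weight b X C" by simp
        qed
        also have "\<dots> \<le> (\<Sum>C\<in>\<C>. 2 * weight b X C)"
          by (rule sum_mono2) (use fin weight_pos[of b X] in \<open>auto simp: less_imp_le\<close>)
        also have "\<dots> < 1" using small by (simp flip: sum_distrib_left)
        finally show ?thesis .
      qed
      then show ?thesis
        using 1 S by (simp add: free_elements_def maker_claims_def)
    next
      case 2
      define f where "f = (SOME f. heaviest h f)"
      have S: "S = {f}" using follows 2 by (simp add: s_def f_def)
      have hf: "heaviest h f"
        using heaviest_exists legal by (simp add: legal_move_def f_def)
      have "danger \<C> b (insert f (maker_claims h)) (free_elements X h - {f} - T) < 1"
        if "T \<subseteq> free_elements X h - {f}" "card T \<le> b" for T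
        using danger_round[of \<C> "free_elements X h" b f "maker_claims h" T]
          fin fin_free b hf that 2 IH by (force simp: heaviest_def)
      then show ?thesis
        using 2 IH S by (simp add: free_elements_snoc maker_claims_snoc)
    next
      case 3
      then have "S \<subseteq> free_elements X h" "card S \<le> b" using legal by (auto simp: legal_move_def)
      then show ?thesis
        using 3 IH by (auto simp: free_elements_snoc maker_claims_snoc)
    qed
  qed
  have "\<exists>F\<in>\<F>. F \<subseteq> maker_claims h"
    if play: "is_play 1 b X h" "follows_strategy s h" and over: "free_elements X h = {}" for h
  proof (rule win)
    have "h \<noteq> []" using over X by (auto simp: free_elements_Nil)
    then have e: "e \<in> maker_claims h" and "danger \<C> b (maker_claims h) {} < 1"
      using invariant[OF play] over by (auto split: if_splits)
    then have "real (card {C \<in> \<C>. C \<inter> maker_claims h = {}}) < 1"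
      by (simp add: danger_def weight_def)
    then have "{C \<in> \<C>. C \<inter> maker_claims h = {}} = {}"
      using fin by simp
    then show "C \<inter> maker_claims h \<noteq> {}" if "C \<in> \<C>" for C using that by blast
    show "e \<in> maker_claims h" by (rule e)
    show "maker_claims h \<subseteq> X" using play by (blast dest: maker_claims_subset)
  qed
  then have "maker_winning_strategy 1 b X \<F> s"
    using s_legal by (auto simp: maker_winning_strategy_def)
  then show ?thesis by (auto simp: maker_has_winning_strategy_def)
qed

section \<open>Partitions into few robustly connected classes\<close>

definition entropy_term :: "nat \<Rightarrow> real" where
  "entropy_term m = real m * log 2 (real m)"

text \<open>
  Counted as ordered pairs, so that edges inside \<open>X\<close> enter \<open>pairs A X X\<close> twice.
\<close>

definition pairs :: "('a \<Rightarrow> 'a \<Rightarrow> bool) \<Rightarrow> 'a set \<Rightarrow> 'a set \<Rightarrow> real" where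
  "pairs A X Y = (\<Sum>x\<in>X. \<Sum>y\<in>Y. of_bool (A x y))"

text \<open>
  A class earns its internal edges but pays for its entropy. Cutting \<open>S\<close> off a class at least twice
  as large lowers the entropy term by at least \<open>card S\<close>, so it pays off unless \<open>S\<close> sends at least
  \<open>\<tau> * card S\<close> edges to the rest, while merging \<open>Q\<close> into another class costs only
  \<open>2 * card Q * log 2 n\<close> in entropy, however large that class is.
\<close>

definition score :: "('a \<Rightarrow> 'a \<Rightarrow> bool) \<Rightarrow> real \<Rightarrow> 'a set \<Rightarrow> real" where
  "score A \<tau> X = pairs A X X - 2 * \<tau> * entropy_term (card X)"

lemma entropy_term_split:
  assumes "0 < s" "s \<le> t"
  shows "real s \<le> entropy_term (s + t) - entropy_term s - entropy_term t"
proof -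
  have "1 + log 2 (real s) = log 2 (2 * real s)"
    using assms by (simp add: log_mult)
  also have "\<dots> \<le> log 2 (real (s + t))" using assms by simp
  finally have "real s * (1 + log 2 (real s)) \<le> real s * log 2 (real (s + t))"
    by (intro mult_left_mono) auto
  moreover have "real t * log 2 (real t) \<le> real t * log 2 (real (s + t))"
    using assms by (intro mult_left_mono) auto
  ultimately show ?thesis
    by (simp add: entropy_term_def algebra_simps)
qed

lemma entropy_term_merge:
  assumes "0 < q" "0 < r" "q + r \<le> n" "4 \<le> n"
  shows "entropy_term (q + r) - entropy_term q - entropy_term r \<le> 2 * real q * log 2 (real n)"
proof -
  have ln2: "1 / ln 2 \<le> (2::real)" using ln2_ge_two_thirds by (simp add: divide_le_eq)
  have "1 + real q / real r = real (q + r) / real r" using assms by (simp add: field_simps)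
  then have "log 2 (real (q + r)) - log 2 (real r) = log 2 (1 + real q / real r)"
    using assms by (simp add: log_divide)
  also have "\<dots> = ln (1 + real q / real r) / ln 2" by (simp add: log_def)
  also have "\<dots> \<le> (real q / real r) / ln 2"
    using ln_add_one_self_le_self[of "real q / real r"] by (intro divide_right_mono) auto
  also have "\<dots> \<le> (real q / real r) * 2"
    using mult_left_mono[OF ln2, of "real q / real r"] by simp
  finally have "real r * (log 2 (real (q + r)) - log 2 (real r)) \<le> real r * (real q / real r * 2)"
    by (intro mult_left_mono) auto
  also have "\<dots> = real q * 2" using assms by simp
  also have "\<dots> \<le> real q * log 2 (real n)"
    using assms by (intro mult_left_mono) (auto simp: le_log_iff)
  finally have "real r * (log 2 (real (q + r)) - log 2 (real r)) \<le> real q * log 2 (real n)" .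
  moreover have "real q * log 2 (real (q + r)) \<le> real q * log 2 (real n)"
    using assms by (intro mult_left_mono) auto
  moreover have "0 \<le> real q * log 2 (real q)" using assms by simp
  ultimately show ?thesis
    by (simp add: entropy_term_def algebra_simps)
qed

lemma pairs_commute:
  assumes "\<And>x y. A x y \<longleftrightarrow> A y x"
  shows "pairs A X Y = pairs A Y X"
  unfolding pairs_def using assms by (subst sum.swap) simp

lemma pairs_empty: "pairs A {} Y = 0"
  by (simp add: pairs_def)

lemma pairs_eq_sum_card:
  "finite Y \<Longrightarrow> pairs A X Y = (\<Sum>x\<in>X. real (card {y \<in> Y. A x y}))"
  by (simp add: pairs_def Int_def)

lemma pairs_union_right:
  assumes "finite Y" "finite Z" "Y \<inter> Z = {}"
  shows "pairs A X (Y \<union> Z) = pairs A X Y + pairs A X Z"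
  unfolding pairs_def sum.distrib[symmetric]
  by (intro sum.cong refl sum.union_disjoint assms)

lemma score_union:
  assumes "finite X" "finite Y" "X \<inter> Y = {}" and sym: "\<And>x y. A x y \<longleftrightarrow> A y x"
  shows "score A \<tau> (X \<union> Y) = score A \<tau> X + score A \<tau> Y + 2 * pairs A X Y
     - 2 * \<tau> * (entropy_term (card X + card Y) - entropy_term (card X) - entropy_term (card Y))"
proof -
  have "pairs A (X \<union> Y) (X \<union> Y) = pairs A X (X \<union> Y) + pairs A Y (X \<union> Y)"
    unfolding pairs_def using assms by (simp add: sum.union_disjoint)
  then show ?thesis
    using assms pairs_commute[of A Y X]
    by (simp add: score_def pairs_union_right card_Un_disjoint algebra_simps)
qed

lemma score_empty: "score A \<tau> {} = 0"
  by (simp add: score_def entropy_term_def pairs_empty)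

definition fiber :: "'a set \<Rightarrow> ('a \<Rightarrow> nat) \<Rightarrow> nat \<Rightarrow> 'a set" where
  "fiber V p i = {v \<in> V. p v = i}"

lemma sum_remove_two:
  fixes g :: "nat \<Rightarrow> real"
  assumes "i < K" "j < K" "i \<noteq> j"
  shows "(\<Sum>k<K. g k) = g i + g j + (\<Sum>k\<in>{..<K} - {i} - {j}. g k)"
  using assms by (simp add: sum.remove[of "{..<K}" i] sum.remove[of "{..<K} - {i}" j])

text \<open>
  Redistributing two classes of a best partition among themselves cannot improve it. Both the
  splitting of a class into an empty one and the merging of two classes are of this kind.
\<close>

lemma exists_best_partition:
  assumes "finite V" "0 < K"
  obtains p where "\<And>v. v \<in> V \<Longrightarrow> p v < K"
    and "\<And>i j X Y. \<lbrakk>i < K; j < K; i \<noteq> j; X \<inter> Y = {}; X \<union> Y = fiber V p i \<union> fiber V p j\<rbrakk>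
           \<Longrightarrow> score A \<tau> X + score A \<tau> Y \<le> score A \<tau> (fiber V p i) + score A \<tau> (fiber V p j)"
proof -
  define total where "total p = (\<Sum>i<K. score A \<tau> (fiber V p i))" for p
  let ?P = "V \<rightarrow>\<^sub>E {..<K}"
  have fin: "finite ?P" using assms by (intro finite_PiE) auto
  moreover have "?P \<noteq> {}" using assms by (auto simp: PiE_eq_empty_iff)
  ultimately have "Max (total ` ?P) \<in> total ` ?P" by (intro Max_in) auto
  then obtain p where p: "p \<in> ?P" "total p = Max (total ` ?P)" by auto
  have best: "total q \<le> total p" if "q \<in> ?P" for q using p fin that by simp
  show thesis
  proof
    show "p v < K" if "v \<in> V" for v using p that by auto
    fix i j X Y
    assume ij: "i < K" "j < K" "i \<noteq> j" and disj: "X \<inter> Y = {}"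
      and XY: "X \<union> Y = fiber V p i \<union> fiber V p j"
    define q where "q v = (if v \<in> X then i else if v \<in> Y then j else p v)" for v
    have sub: "X \<subseteq> V" "Y \<subseteq> V" using XY by (auto simp: fiber_def)
    have "q \<in> ?P" using p ij sub by (auto simp: q_def PiE_iff extensional_def)
    then have "total q \<le> total p" by (rule best)
    moreover have "fiber V q i = X"
      using XY disj ij sub by (auto simp: fiber_def q_def)
    moreover have "fiber V q j = Y"
      using XY disj ij sub by (auto simp: fiber_def q_def)
    moreover have "fiber V q k = fiber V p k" if "k \<noteq> i" "k \<noteq> j" for k
      using XY that by (auto simp: fiber_def q_def)
    then have "(\<Sum>k\<in>{..<K} - {i} - {j}. score A \<tau> (fiber V q k))
             = (\<Sum>k\<in>{..<K} - {i} - {j}. score A \<tau> (fiber V p k))"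
      by (intro sum.cong) auto
    ultimately show "score A \<tau> X + score A \<tau> Y
        \<le> score A \<tau> (fiber V p i) + score A \<tau> (fiber V p j)"
      using ij by (simp add: total_def sum_remove_two)
  qed
qed

text \<open>
  In a partition of maximal total score, a set \<open>S\<close> of at most half of its class must send
  \<open>\<tau> * card S\<close> edges to the rest of the class, since otherwise splitting the class would be
  profitable; the split needs an empty class to receive \<open>S\<close>. One exists, for otherwise the
  smallest class \<open>Q\<close> has at most \<open>n / K\<close> vertices, so the vertices of \<open>Q\<close> have, on average, more
  than \<open>2 * \<tau> * log 2 n\<close> neighbours in some other class, and merging \<open>Q\<close> with that class would be
  profitable. Bounding the number of classes by \<open>K\<close> in advance excludes partitions into
  many tiny classes, against which the merging argument is powerless.
\<close>

theorem robustly_connected_partition: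
  fixes D \<tau> :: real
  assumes V: "finite V" "card V = n" "4 \<le> n" and K: "0 < K"
    and sym: "\<And>x y. A x y \<longleftrightarrow> A y x"
    and deg: "\<And>v. v \<in> V \<Longrightarrow> D \<le> real (card {u \<in> V. A v u})"
    and \<tau>: "0 \<le> \<tau>" and D: "real n / real K + 2 * real K * \<tau> * log 2 (real n) < D"
  obtains p where "\<And>v. v \<in> V \<Longrightarrow> p v < K"
    and "\<And>i S. \<lbrakk>i < K; S \<subseteq> fiber V p i; S \<noteq> {}; 2 * card S \<le> card (fiber V p i)\<rbrakk>
           \<Longrightarrow> \<tau> * real (card S) \<le> pairs A S (fiber V p i - S)"
proof -
  obtain p where p: "\<And>v. v \<in> V \<Longrightarrow> p v < K"
    and best: "\<And>i j X Y. \<lbrakk>i < K; j < K; i \<noteq> j; X \<inter> Y = {}; X \<union> Y = fiber V p i \<union> fiber V p j\<rbrakk>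
           \<Longrightarrow> score A \<tau> X + score A \<tau> Y \<le> score A \<tau> (fiber V p i) + score A \<tau> (fiber V p j)"
    using exists_best_partition[OF V(1) K] by metis
  let ?F = "fiber V p"
  have fin: "finite (?F i)" for i using V by (simp add: fiber_def)
  have disj: "?F i \<inter> ?F j = {}" if "i \<noteq> j" for i j using that by (auto simp: fiber_def)
  have cover: "(\<Union>i<K. ?F i) = V" using p by (auto simp: fiber_def)
  have sum_sizes: "(\<Sum>i<K. card (?F i)) = n"
    using card_UN_disjoint[of "{..<K}" ?F] fin disj cover V by simp
  have L: "0 \<le> log 2 (real n)" using V by simp
  have "\<exists>j<K. ?F j = {}"
  proof (rule ccontr)
    assume "\<not> ?thesis"
    then have nonempty: "?F j \<noteq> {}" if "j < K" for j using that by blast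
    then have pos: "0 < card (?F j)" if "j < K" for j using that fin by (simp add: card_gt_0_iff)
    obtain i where i: "i < K" and smallest: "\<And>j. j < K \<Longrightarrow> card (?F i) \<le> card (?F j)"
      using arg_min_if_finite[of "{..<K}" "\<lambda>j. card (?F j)"] K by (metis finite_lessThan
          lessThan_iff lessThan_empty_iff not_gr_zero not_less bot_nat_def)
    let ?Q = "?F i" let ?q = "real (card ?Q)"
    have merge: "pairs A ?Q (?F j) \<le> 2 * \<tau> * ?q * log 2 (real n)" if j: "j < K" "j \<noteq> i" for j
    proof -
      have "score A \<tau> (?Q \<union> ?F j) + score A \<tau> {} \<le> score A \<tau> ?Q + score A \<tau> (?F j)"
        using best[of i j "?Q \<union> ?F j" "{}"] i j by simp
      then have "pairs A ?Q (?F j) \<le> \<tau> * (entropy_term (card ?Q + card (?F j))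
          - entropy_term (card ?Q) - entropy_term (card (?F j)))"
        using score_union[of ?Q "?F j" A \<tau>] fin disj[of i j] j sym by (simp add: score_empty)
      also have "\<dots> \<le> \<tau> * (2 * ?q * log 2 (real n))"
      proof (intro mult_left_mono entropy_term_merge)
        have "card ?Q + card (?F j) = card (?Q \<union> ?F j)"
          using fin disj[of i j] j by (simp add: card_Un_disjoint)
        also have "\<dots> \<le> n" using V by (auto simp: fiber_def intro!: card_mono)
        finally show "card ?Q + card (?F j) \<le> n" .
      qed (use pos i j \<tau> V in auto)
      finally show ?thesis by (simp add: mult_ac)
    qed
    have "?q * D = (\<Sum>v\<in>?Q. D)" by simp
    also have "\<dots> \<le> (\<Sum>v\<in>?Q. real (card {u \<in> V. A v u}))"
      by (rule sum_mono) (use deg in \<open>auto simp: fiber_def\<close>)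
    also have "\<dots> = pairs A ?Q V" using V by (simp add: pairs_eq_sum_card)
    also have "\<dots> = (\<Sum>j<K. pairs A ?Q (?F j))"
    proof -
      have "pairs A ?Q V = (\<Sum>x\<in>?Q. \<Sum>j<K. \<Sum>y\<in>?F j. of_bool (A x y))"
        unfolding pairs_def
        by (subst cover[symmetric], subst sum.UNION_disjoint) (use fin disj in auto)
      then show ?thesis by (subst (asm) sum.swap) (simp add: pairs_def)
    qed
    also have "\<dots> = pairs A ?Q ?Q + (\<Sum>j\<in>{..<K} - {i}. pairs A ?Q (?F j))"
      using i by (simp add: sum.remove[of _ i])
    also have "(\<Sum>j\<in>{..<K} - {i}. pairs A ?Q (?F j))
        \<le> real (card ({..<K} - {i})) * (2 * \<tau> * ?q * log 2 (real n))"
      by (rule sum_bounded_above) (use merge in auto)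
    also have "\<dots> \<le> real K * (2 * \<tau> * ?q * log 2 (real n))"
      using i \<tau> L by (intro mult_right_mono) auto
    also have "pairs A ?Q ?Q \<le> ?q * ?q"
    proof -
      have "pairs A ?Q ?Q \<le> (\<Sum>x\<in>?Q. \<Sum>y\<in>?Q. 1)"
        unfolding pairs_def by (intro sum_mono) auto
      then show ?thesis by simp
    qed
    finally have "?q * D \<le> ?q * (?q + 2 * real K * \<tau> * log 2 (real n))"
      by (simp add: algebra_simps)
    then have "D \<le> ?q + 2 * real K * \<tau> * log 2 (real n)"
      using pos[OF i] by simp
    moreover have "?q \<le> real n / real K"
    proof -
      have "K * card ?Q \<le> n"
        using sum_bounded_below[of "{..<K}" "card ?Q" "\<lambda>j. card (?F j)"] smallest sum_sizes by simp
      then have "real K * ?q \<le> real n" by (metis of_nat_le_iff of_nat_mult)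
      then show ?thesis using K by (simp add: pos_le_divide_eq mult.commute)
    qed
    ultimately show False using D by simp
  qed
  then obtain j where j: "j < K" "?F j = {}" by blast
  show thesis
  proof (rule that)
    show "p v < K" if "v \<in> V" for v using p that .
    fix i S
    assume i: "i < K" and S: "S \<subseteq> ?F i" "S \<noteq> {}" "2 * card S \<le> card (?F i)"
    let ?T = "?F i - S"
    have fS: "finite S" using S fin finite_subset by blast
    have card_T: "card ?T = card (?F i) - card S" using S fS by (simp add: card_Diff_subset)
    have union: "S \<union> ?T = ?F i" using S by auto
    have "i \<noteq> j" using S j by auto
    then have "score A \<tau> S + score A \<tau> ?T \<le> score A \<tau> (S \<union> ?T)"
      using best[of i j S ?T] i j union by (simp add: score_empty)
    then have "\<tau> * (entropy_term (card S + card ?T) - entropy_term (card S)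
        - entropy_term (card ?T)) \<le> pairs A S ?T"
      using score_union[of S ?T A \<tau>] fS fin sym by simp
    moreover have "\<tau> * real (card S) \<le> \<tau> * (entropy_term (card S + card ?T)
        - entropy_term (card S) - entropy_term (card ?T))"
      using S fS card_T \<tau> by (intro mult_left_mono entropy_term_split) (auto simp: card_gt_0_iff)
    ultimately show "\<tau> * real (card S) \<le> pairs A S ?T" by linarith
  qed
qed

section \<open>Large bipartite subgraphs and their cuts\<close>

definition crossing :: "'a set \<Rightarrow> 'a set \<Rightarrow> bool" where
  "crossing X e \<longleftrightarrow> e \<inter> X \<noteq> {} \<and> e - X \<noteq> {}"

definition cross_adjacent :: "'a set set \<Rightarrow> 'a set \<Rightarrow> 'a \<Rightarrow> 'a \<Rightarrow> bool" where
  "cross_adjacent E X u v \<longleftrightarrow> {u, v} \<in> E \<and> (u \<in> X \<longleftrightarrow> v \<notin> X)"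

lemma cross_adjacent_sym: "cross_adjacent E X u v \<longleftrightarrow> cross_adjacent E X v u"
  by (auto simp: cross_adjacent_def insert_commute)

text \<open>In a maximum cut, no vertex gains from changing sides.\<close>

lemma max_cut_keeps_half_of_each_degree:
  assumes "simple_graph V E"
  obtains X where "\<And>v. v \<in> V \<Longrightarrow> vertex_degree E v \<le> 2 * card {u \<in> V. cross_adjacent E X v u}"
proof -
  have fV: "finite V" and edge: "\<And>e. e \<in> E \<Longrightarrow> e \<subseteq> V \<and> card e = 2"
    using assms by (auto simp: simple_graph_def)
  have fE: "finite E" using fV edge by (meson Pow_iff finite_Pow_iff finite_subset subsetI)
  define size where "size X = card {e \<in> E. crossing X e}" for X
  have "Max (size ` Pow V) \<in> size ` Pow V" using fV by (intro Max_in) auto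
  then obtain X where X: "X \<subseteq> V" "size X = Max (size ` Pow V)" by auto
  have best: "size Y \<le> size X" if "Y \<subseteq> V" for Y using X fV that by simp
  have "vertex_degree E v \<le> 2 * card {u \<in> V. cross_adjacent E X v u}" if v: "v \<in> V" for v
  proof -
    define Y where "Y = (if v \<in> X then X - {v} else insert v X)"
    define inc where "inc Z = card {e \<in> E. v \<in> e \<and> crossing Z e}" for Z
    define rest where "rest Z = card {e \<in> E. v \<notin> e \<and> crossing Z e}" for Z
    have split: "size Z = inc Z + rest Z" for Z
      unfolding size_def inc_def rest_def
      by (subst card_Un_disjoint[symmetric]) (use fE in \<open>auto intro!: arg_cong[where f = card]\<close>)
    have rest: "rest Y = rest X"
      unfolding rest_def Y_def crossing_def by (intro arg_cong[where f = card]) auto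
    have flip: "crossing Y e \<longleftrightarrow> \<not> crossing X e" if e: "e \<in> E" "v \<in> e" for e
    proof -
      obtain u where "e = {v, u}" "u \<noteq> v" using edge[OF e(1)] e(2) by (auto simp: card_2_iff)
      then show ?thesis by (auto simp: crossing_def Y_def)
    qed
    have "vertex_degree E v = card ({e \<in> E. v \<in> e \<and> crossing X e} \<union> {e \<in> E. v \<in> e \<and> crossing Y e})"
      unfolding vertex_degree_def using flip by (intro arg_cong[where f = card]) auto
    also have "\<dots> = inc X + inc Y"
      unfolding inc_def by (rule card_Un_disjoint) (use fE flip in auto)
    also have "inc Y \<le> inc X"
    proof -
      have "size Y \<le> size X" using X v by (intro best) (auto simp: Y_def)
      then show ?thesis by (simp add: split rest)
    qed
    finally have "vertex_degree E v \<le> 2 * inc X" by simp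
    also have "inc X = card ((\<lambda>u. {v, u}) ` {u \<in> V. cross_adjacent E X v u})"
      unfolding inc_def
    proof (intro arg_cong[where f = card] equalityI subsetI)
      fix e assume e: "e \<in> {e \<in> E. v \<in> e \<and> crossing X e}"
      then obtain u where "e = {v, u}" "u \<noteq> v" using edge[of e] by (auto simp: card_2_iff)
      then show "e \<in> (\<lambda>u. {v, u}) ` {u \<in> V. cross_adjacent E X v u}"
        using e edge[of e] by (auto simp: crossing_def cross_adjacent_def)
    qed (auto simp: crossing_def cross_adjacent_def)
    also have "\<dots> = card {u \<in> V. cross_adjacent E X v u}"
      by (intro card_image inj_onI) (auto simp: doubleton_eq_iff)
    finally show ?thesis .
  qed
  then show thesis using that by blast
qed

definition cut :: "('a \<Rightarrow> 'a \<Rightarrow> bool) \<Rightarrow> 'a set \<Rightarrow> 'a set \<Rightarrow> 'a set set" where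
  "cut A S T = {{x, y} | x y. x \<in> S \<and> y \<in> T \<and> A x y}"

lemma card_cut:
  assumes "finite S" "finite T" "S \<inter> T = {}"
  shows "real (card (cut A S T)) = pairs A S T"
proof -
  have "cut A S T = (\<lambda>(x, y). {x, y}) ` (SIGMA x:S. {y \<in> T. A x y})"
    by (auto simp: cut_def)
  moreover have "inj_on (\<lambda>(x, y). {x, y}) (SIGMA x:S. {y \<in> T. A x y})"
    using assms by (auto simp: inj_on_def doubleton_eq_iff)
  ultimately have "card (cut A S T) = card (SIGMA x:S. {y \<in> T. A x y})"
    by (simp add: card_image)
  then show ?thesis using assms by (simp add: pairs_eq_sum_card)
qed

text \<open>
  Two proper two-colourings of a connected bipartite graph agree everywhere or nowhere: the set
  \<open>S\<close> where a given colouring agrees with the bipartition has no edge of the bipartite graph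
  leaving it. Either way an edge inside one side becomes monochromatic.
\<close>

lemma not_two_colorable_if_cuts_hit:
  assumes W: "W \<subseteq> V" and e: "{u, v} \<in> M" "u \<in> W" "v \<in> W" "u \<in> X \<longleftrightarrow> v \<in> X"
    and hit: "\<And>S. \<lbrakk>S \<subseteq> W; S \<noteq> {}; S \<noteq> W\<rbrakk> \<Longrightarrow> cut (cross_adjacent E X) S (W - S) \<inter> M \<noteq> {}"
  shows "\<not> colorable V M 2"
proof
  assume "colorable V M 2"
  then obtain c :: "'a \<Rightarrow> nat" where c: "\<And>x. x \<in> V \<Longrightarrow> c x < 2"
    and proper: "\<And>x y. {x, y} \<in> M \<Longrightarrow> c x \<noteq> c y"
    by (auto simp: colorable_def)
  have two: "c x = 0 \<or> c x = 1" if "x \<in> W" for x using c[of x] that W by auto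
  define S where "S = {x \<in> W. c x = of_bool (x \<in> X)}"
  have "S = {} \<or> S = W"
  proof (rule ccontr)
    assume "\<not> ?thesis"
    then have "cut (cross_adjacent E X) S (W - S) \<inter> M \<noteq> {}"
      by (intro hit) (auto simp: S_def)
    then obtain x y where xy: "x \<in> S" "y \<in> W" "y \<notin> S" "x \<in> X \<longleftrightarrow> y \<notin> X" "{x, y} \<in> M"
      by (auto simp: cut_def cross_adjacent_def)
    then show False using proper[OF xy(5)] two[of y] by (auto simp: S_def split: if_splits)
  qed
  then have "(c u = of_bool (u \<in> X)) = (c v = of_bool (v \<in> X))"
    using e unfolding S_def by blast
  then have "c u = c v" using e two[of u] two[of v] by auto
  then show False using proper[OF e(1)] by simp
qed

section \<open>Winning the odd cycle game\<close>

lemma sum_over_nonempty_subsets_less_half: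
  assumes "finite W" "card W \<le> n" "4 \<le> n"
  shows "(\<Sum>S\<in>Pow W - {{}}. (1 / (real n)\<^sup>2) ^ card S) < 1 / 2"
proof -
  let ?x = "1 / (real n)\<^sup>2"
  have n: "real n \<ge> 4" using assms by simp
  have "(\<Sum>S\<in>Pow W. ?x ^ card S) = (\<Prod>w\<in>W. ?x + 1)"
    using prod_add[OF assms(1), of "\<lambda>_. ?x" "\<lambda>_. 1"] by simp
  also have "\<dots> = (1 + ?x) ^ card W" by (simp add: add.commute)
  also have "\<dots> \<le> exp ?x ^ card W" by (intro power_mono) auto
  also have "\<dots> = exp (real (card W) * ?x)" by (rule exp_of_nat_mult[symmetric])
  also have "\<dots> \<le> exp (1 / 4)"
  proof -
    have "real (card W) * ?x \<le> real n * ?x" using assms by (intro mult_right_mono) auto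
    also have "\<dots> = 1 / real n" by (simp add: power2_eq_square)
    also have "\<dots> \<le> 1 / 4" using n by (intro divide_left_mono) auto
    finally show ?thesis by simp
  qed
  also have "\<dots> \<le> 1 + 1 / 4 + (1 / 4)\<^sup>2" by (rule exp_bound) auto
  also have "\<dots> < 1 + 1 / (2::real)" by (simp add: power2_eq_square)
  finally have "(\<Sum>S\<in>Pow W. ?x ^ card S) < 1 + 1 / 2" .
  moreover have "(\<Sum>S\<in>Pow W. ?x ^ card S) = 1 + (\<Sum>S\<in>Pow W - {{}}. ?x ^ card S)"
    using assms by (subst sum.remove[of _ "{}"]) auto
  ultimately show ?thesis by simp
qed

text \<open>
  A cut that separates \<open>s\<close> vertices has initial weight at most \<open>n powr (-2 * s)\<close>, which
  beats their number, at most \<open>n choose s\<close>.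
\<close>

lemma maker_wins_from_robust_class:
  assumes G: "simple_graph V E" "card V = n" "4 \<le> n" and b: "0 < b"
    and W: "W \<subseteq> V" and uv: "{u, v} \<in> E" "u \<in> W" "v \<in> W" "u \<in> X \<longleftrightarrow> v \<in> X"
    and robust: "\<And>S. \<lbrakk>S \<subseteq> W; S \<noteq> {}; 2 * card S \<le> card W\<rbrakk> \<Longrightarrow>
       2 * real b * log 2 (real n) * real (card S) \<le> pairs (cross_adjacent E X) S (W - S)"
  shows "maker_has_winning_strategy 1 b E (odd_cycle_winning_sets V E)"
proof -
  let ?A = "cross_adjacent E X"
  have fV: "finite V" and fW: "finite W" using G W finite_subset by (auto simp: simple_graph_def)
  have "E \<subseteq> Pow V" using G by (auto simp: simple_graph_def)
  then have fE: "finite E" using fV finite_subset by blast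
  define J where "J = {S. S \<subseteq> W \<and> S \<noteq> {} \<and> 2 * card S \<le> card W}"
  have fJ: "finite J" using fW by (simp add: J_def)
  have cut_sub: "cut ?A S T \<subseteq> E" for S T by (auto simp: cut_def cross_adjacent_def)
  have weight_le: "weight b E (cut ?A S (W - S)) \<le> (1 / (real n)\<^sup>2) ^ card S" if S: "S \<in> J" for S
  proof -
    have "finite S" using S fW finite_subset by (auto simp: J_def)
    then have "2 * real b * log 2 (real n) * real (card S) \<le> real (card (cut ?A S (W - S)))"
      using robust[of S] S fW by (subst card_cut) (auto simp: J_def)
    then have "2 * log 2 (real n) * real (card S) \<le> real (card (cut ?A S (W - S))) / real b"
      using b by (simp add: pos_le_divide_eq mult_ac)
    then have "weight b E (cut ?A S (W - S)) \<le> 2 powr (log 2 (real n) * (- 2 * real (card S)))"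
      unfolding weight_def using Int_absorb2[OF cut_sub, of S "W - S"] by simp
    also have "\<dots> = real n powr (- 2 * real (card S))"
      using G by (subst powr_powr[symmetric]) simp
    also have "\<dots> = (real n powr (- 2)) powr real (card S)" by (simp add: powr_powr)
    also have "\<dots> = (1 / (real n)\<^sup>2) ^ card S"
      using G by (simp add: powr_minus_divide powr_realpow)
    finally show ?thesis .
  qed
  show ?thesis
  proof (rule maker_claims_element_and_hits_family[where e = "{u, v}"
        and \<C> = "(\<lambda>S. cut ?A S (W - S)) ` J"])
    have "(\<Sum>C\<in>(\<lambda>S. cut ?A S (W - S)) ` J. weight b E C)
        \<le> (\<Sum>S\<in>J. weight b E (cut ?A S (W - S)))"
      using sum_image_le[OF fJ, of "weight b E" "\<lambda>S. cut ?A S (W - S)"]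
      by (simp add: weight_pos less_imp_le)
    also have "\<dots> \<le> (\<Sum>S\<in>J. (1 / (real n)\<^sup>2) ^ card S)" by (rule sum_mono) (rule weight_le)
    also have "\<dots> \<le> (\<Sum>S\<in>Pow W - {{}}. (1 / (real n)\<^sup>2) ^ card S)"
      by (rule sum_mono2) (use fW in \<open>auto simp: J_def\<close>)
    also have "\<dots> < 1 / 2"
      using fW G card_mono[OF fV W] by (intro sum_over_nonempty_subsets_less_half) auto
    finally show "(\<Sum>C\<in>(\<lambda>S. cut ?A S (W - S)) ` J. weight b E C) < 1 / 2" .
  next
    fix M
    assume M: "M \<subseteq> E" "{u, v} \<in> M"
      and hit: "\<And>C. C \<in> (\<lambda>S. cut ?A S (W - S)) ` J \<Longrightarrow> C \<inter> M \<noteq> {}"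
    have "\<not> colorable V M 2"
    proof (rule not_two_colorable_if_cuts_hit[OF W M(2) uv(2-4)])
      fix S assume S: "S \<subseteq> W" "S \<noteq> {}" "S \<noteq> W"
      have "card S + card (W - S) = card W"
        using S fW by (metis card_Diff_subset card_mono finite_subset le_add_diff_inverse)
      then have "S \<in> J \<or> W - S \<in> J" using S by (auto simp: J_def)
      moreover have "cut ?A (W - S) (W - (W - S)) = cut ?A S (W - S)"
        using S cross_adjacent_sym[of E X] by (auto simp: cut_def double_diff) (metis insert_commute)+
      ultimately show "cut ?A S (W - S) \<inter> M \<noteq> {}" using hit by (metis imageI)
    qed
    moreover have "subgraph V M V E" using G M by (auto simp: subgraph_def simple_graph_def)
    ultimately show "\<exists>F\<in>odd_cycle_winning_sets V E. F \<subseteq> M"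
      by (auto simp: odd_cycle_winning_sets_def)
  qed (use fE uv fJ b in auto)
qed

lemma not_colorable_below_chromatic_number:
  "k < chromatic_number V E \<Longrightarrow> \<not> colorable V E k"
  unfolding chromatic_number_def by (rule not_less_Least)

text \<open>The pairs (class, side) colour the vertices with twice as many colours as classes.\<close>

lemma edge_inside_class_and_side:
  assumes G: "simple_graph V E" and p: "\<And>v. v \<in> V \<Longrightarrow> p v < K"
    and chi: "2 * K < chromatic_number V E"
  obtains u v where "{u, v} \<in> E" "u \<in> V" "v \<in> V" "p u = p v" "u \<in> X \<longleftrightarrow> v \<in> X"
proof -
  define c where "c x = 2 * p x + of_bool (x \<in> X)" for x
  have "c x < 2 * K" if "x \<in> V" for x using p[OF that] by (auto simp: c_def)
  then obtain u v where uv: "{u, v} \<in> E" "c u = c v"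
    using not_colorable_below_chromatic_number[OF chi] unfolding colorable_def by blast
  have "p x = c x div 2" "x \<in> X \<longleftrightarrow> odd (c x)" for x by (auto simp: c_def)
  then have "p u = p v" "u \<in> X \<longleftrightarrow> v \<in> X" using uv by metis+
  moreover have "u \<in> V" "v \<in> V" using uv G by (auto simp: simple_graph_def)
  ultimately show thesis using that uv by blast
qed

text \<open>
  The condition \<open>b * (log 2 n)^2 = O(\<delta>^2 * n)\<close> enters through the parameter
  \<open>\<tau> = 2 * b * log 2 n\<close>: one logarithm is needed to beat the number of cuts in the game, the
  other one is the price of the partition into robustly connected classes.
\<close>

theorem theorem1p3:
  fixes \<delta> :: real
  assumes "0 < \<delta>" and "\<delta> < 1"
  shows "\<exists>n0 :: nat. \<forall>(V :: 'a set) E n.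
           simple_graph V E \<and> card V = n \<and> n \<ge> n0 \<and>
           real (min_degree V E) \<ge> \<delta> * real n \<and>
           real (chromatic_number V E) > 32 / \<delta> \<longrightarrow>
           (\<forall>b :: nat. 0 < b \<and> real b \<le> \<delta>\<^sup>2 * real n / (6400 * (log 2 (real n))\<^sup>2) \<longrightarrow>
              maker_has_winning_strategy 1 b E (odd_cycle_winning_sets V E))"
proof (intro exI[of _ 4] allI impI, elim conjE)
  fix V :: "'a set" and E n b
  assume G: "simple_graph V E" and n: "card V = n" "4 \<le> n"
    and deg: "\<delta> * real n \<le> real (min_degree V E)"
    and chi: "32 / \<delta> < real (chromatic_number V E)"
    and b: "0 < b" "real b \<le> \<delta>\<^sup>2 * real n / (6400 * (log 2 (real n))\<^sup>2)"
  have fV: "finite V" using G by (simp add: simple_graph_def)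
  obtain X where half: "\<And>v. v \<in> V \<Longrightarrow> vertex_degree E v \<le> 2 * card {u \<in> V. cross_adjacent E X v u}"
    using max_cut_keeps_half_of_each_degree[OF G] by blast
  have cross_deg: "\<delta> * real n / 2 \<le> real (card {u \<in> V. cross_adjacent E X v u})"
    if v: "v \<in> V" for v
  proof -
    have "min_degree V E \<le> vertex_degree E v" using fV v by (simp add: min_degree_def)
    with half[OF v] have "real (min_degree V E) \<le> 2 * real (card {u \<in> V. cross_adjacent E X v u})"
      by linarith
    then show ?thesis using deg by linarith
  qed
  \<comment> \<open>At least \<open>4 / \<delta>\<close> classes make the smallest class too small to absorb more than half of the
      degrees of the bipartite graph, and at most \<open>5 / \<delta>\<close> classes keep the number of (class, side) pairs
      below the chromatic number.\<close>
  define K where "K = nat \<lceil>4 / \<delta>\<rceil>"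
  have K_lower: "4 / \<delta> \<le> real K" unfolding K_def using assms by linarith
  have "real K \<le> 4 / \<delta> + 1"
    unfolding K_def using assms of_int_ceiling_le_add_one[of "4 / \<delta>"] by simp
  also have "\<dots> \<le> 5 / \<delta>" using assms by (simp add: divide_simps)
  finally have K_upper: "real K \<le> 5 / \<delta>" .
  have K_pos: "0 < K" using K_lower assms by (intro gr0I) (simp add: divide_le_0_iff)
  let ?L = "log 2 (real n)"
  have L: "0 < ?L" using n by simp
  have "real n / real K + 2 * real K * (2 * real b * ?L) * ?L < \<delta> * real n / 2"
  proof -
    have "real n / real K \<le> real n / (4 / \<delta>)"
      using K_lower K_pos assms by (intro divide_left_mono) auto
    moreover have "real b * ?L\<^sup>2 \<le> \<delta>\<^sup>2 * real n / 6400"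
      using b(2) L by (simp add: field_simps)
    then have "4 * real K * (real b * ?L\<^sup>2) \<le> 4 * (5 / \<delta>) * (\<delta>\<^sup>2 * real n / 6400)"
      using K_upper assms by (intro mult_mono) auto
    then have "2 * real K * (2 * real b * ?L) * ?L \<le> \<delta> * real n / 320"
      using assms by (simp add: power2_eq_square mult_ac)
    moreover have "0 < \<delta> * real n" using assms n by simp
    ultimately show ?thesis by (simp add: mult.commute)
  qed
  then obtain p where p: "\<And>v. v \<in> V \<Longrightarrow> p v < K"
    and robust: "\<And>i S. \<lbrakk>i < K; S \<subseteq> fiber V p i; S \<noteq> {}; 2 * card S \<le> card (fiber V p i)\<rbrakk> \<Longrightarrow>
      2 * real b * ?L * real (card S) \<le> pairs (cross_adjacent E X) S (fiber V p i - S)"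
    using robustly_connected_partition[OF fV n K_pos cross_adjacent_sym cross_deg, of "2 * real b * ?L"]
      b L by (smt (verit) mult_nonneg_nonneg of_nat_0_le_iff)
  have "10 / \<delta> < real (chromatic_number V E)"
    using chi assms divide_right_mono[of 10 32 \<delta>] by linarith
  then have "2 * K < chromatic_number V E" using K_upper by linarith
  then obtain u v where uv: "{u, v} \<in> E" "u \<in> V" "v \<in> V" "p u = p v" "u \<in> X \<longleftrightarrow> v \<in> X"
    using edge_inside_class_and_side[where V = V and p = p and X = X, OF G p] by blast
  show "maker_has_winning_strategy 1 b E (odd_cycle_winning_sets V E)"
    by (rule maker_wins_from_robust_class[where W = "fiber V p (p u)" and u = u and v = v and X = X])
      (use G n b uv p robust in \<open>auto simp: fiber_def\<close>)
qed

end
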